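(* Let $(\Omega,\nu)=\prod_{t=1}^n(\Omega_t,\nu_t)$ be a product of finite probability spaces with $p_t=\min_{\omega\in\Omega_t}\nu_t(\omega)\in(0,\tfrac12)$ for each $t$, and put $\sigma_t=\sqrt{p_t(1-p_t)}$ and $\sigma_S=\prod_{t\in S}\sigma_t$. Let $f\in L^2(\Omega,\nu)$, let $q>2$ be an even integer and let $\rho\le\frac{1}{8q^{1.5}}$. Then $\|\mathrm{T}_\rho f\|_q^q\le\sum_{S\subseteq[n]}\sigma_S^{2-q}\|\mathrm{L}_S[f]\|_2^q$.
   Context: For $J\subseteq[n]$ let $f^{\subseteq J}=\mathbb{E}[f\mid\omega_J]$ (averaging over the coordinates outside $J$), and define the Efron–Stein components $f^{=S}=\sum_{J\subseteq S}(-1)^{|S\setminus J|}f^{\subseteq J}$, so $f=\sum_Sf^{=S}$. The noise operator is $\mathrm{T}_\rho f=\sum_S\rho^{|S|}f^{=S}$ (equivalently, average of $f$ over $\mathbf y$ where each $y_i=x_i$ with probability $\rho$ and is otherwise resampled from $\nu_i$), and the Laplacian is $\mathrm{L}_T[f]=\sum_{S\supseteq T}f^{=S}$. Norms are in $L^r(\Omega,\nu)$. *)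

theory Defs
  imports "HOL-Probability.Probability"
begin

text \<open>
  A function on the product space is a real function on \<^typ>\<open>'i \<Rightarrow> 'a\<close>, where the points of the
  space are the functions that take the value \<^const>\<open>undefined\<close> outside the finite index set \<open>I\<close>.
\<close>

definition prod_space :: "'i set \<Rightarrow> ('i \<Rightarrow> 'a pmf) \<Rightarrow> ('i \<Rightarrow> 'a) pmf" where
  "prod_space I \<nu> = Pi_pmf I undefined \<nu>"

definition Lr_norm :: "'b pmf \<Rightarrow> real \<Rightarrow> ('b \<Rightarrow> real) \<Rightarrow> real" where
  "Lr_norm M r f = (measure_pmf.expectation M (\<lambda>x. \<bar>f x\<bar> powr r)) powr (1 / r)"

text \<open>
  The conditional expectation of \<open>f\<close> given the coordinates in \<open>J\<close>, for \<open>J \<subseteq> I\<close>. The point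
  \<^term>\<open>merge J (I - J) (x, y)\<close> agrees with \<open>x\<close> on \<open>J\<close> and with \<open>y\<close> on \<open>I - J\<close>.
\<close>

definition avg_outside ::
  "'i set \<Rightarrow> ('i \<Rightarrow> 'a pmf) \<Rightarrow> 'i set \<Rightarrow> (('i \<Rightarrow> 'a) \<Rightarrow> real) \<Rightarrow> ('i \<Rightarrow> 'a) \<Rightarrow> real" where
  "avg_outside I \<nu> J f x =
     measure_pmf.expectation (prod_space (I - J) \<nu>) (\<lambda>y. f (merge J (I - J) (x, y)))"

definition efron_stein ::
  "'i set \<Rightarrow> ('i \<Rightarrow> 'a pmf) \<Rightarrow> 'i set \<Rightarrow> (('i \<Rightarrow> 'a) \<Rightarrow> real) \<Rightarrow> ('i \<Rightarrow> 'a) \<Rightarrow> real" where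
  "efron_stein I \<nu> S f x = (\<Sum>J\<in>Pow S. (- 1) ^ card (S - J) * avg_outside I \<nu> J f x)"

definition noise_op ::
  "'i set \<Rightarrow> ('i \<Rightarrow> 'a pmf) \<Rightarrow> real \<Rightarrow> (('i \<Rightarrow> 'a) \<Rightarrow> real) \<Rightarrow> ('i \<Rightarrow> 'a) \<Rightarrow> real" where
  "noise_op I \<nu> \<rho> f x = (\<Sum>S\<in>Pow I. \<rho> ^ card S * efron_stein I \<nu> S f x)"

definition laplacian ::
  "'i set \<Rightarrow> ('i \<Rightarrow> 'a pmf) \<Rightarrow> 'i set \<Rightarrow> (('i \<Rightarrow> 'a) \<Rightarrow> real) \<Rightarrow> ('i \<Rightarrow> 'a) \<Rightarrow> real" where
  "laplacian I \<nu> T f x = (\<Sum>S | T \<subseteq> S \<and> S \<subseteq> I. efron_stein I \<nu> S f x)"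

definition min_prob :: "'a set \<Rightarrow> 'a pmf \<Rightarrow> real" where
  "min_prob \<Omega> \<nu> = Min (pmf \<nu> ` \<Omega>)"

definition sigma_set :: "('i \<Rightarrow> 'a set) \<Rightarrow> ('i \<Rightarrow> 'a pmf) \<Rightarrow> 'i set \<Rightarrow> real" where
  "sigma_set \<Omega> \<nu> S =
     (\<Prod>t\<in>S. sqrt (min_prob (\<Omega> t) (\<nu> t) * (1 - min_prob (\<Omega> t) (\<nu> t))))"

end

theory Submission
  imports Defs
begin

text \<open>
  Induction on the number of coordinates, for functions with values in a finite-dimensional weighted
  Euclidean space. Splitting off one coordinate \<open>i\<close>, write \<open>f = f\<^sub>0 + g\<close> with \<open>f\<^sub>0\<close> the average of
  \<open>f\<close> over that coordinate. For fixed other coordinates, a vector \<open>a\<close> and a mean-zero vector-valued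
  \<open>g\<close> on one site satisfy
  \<open>E \<bar>a + \<rho> g\<bar>^(2m) \<le> (\<bar>a\<bar>^2 + E \<bar>g\<bar>^2)^m + \<sigma>^(2-2m) (E \<bar>g\<bar>^2)^m\<close>,
  because the linear term vanishes and \<open>\<bar>g\<bar>^2 \<le> \<sigma>^(-2) E \<bar>g\<bar>^2\<close> pointwise. Both terms on the right
  are again \<open>2m\<close>-th powers of norms of vector-valued functions of the remaining coordinates, namely
  of \<open>(T f\<^sub>0, T g)\<close> and of \<open>T g\<close>, so the induction hypothesis applies. The first accounts for the
  Laplacians \<open>L\<^sub>S\<close> with \<open>i \<notin> S\<close> and the second for those with \<open>i \<in> S\<close>.
\<close>

subsection \<open>The inequality on one site\<close>

text \<open>In the binomial expansion of \<open>(X + z) ^ m - (X + y) ^ m\<close> every term is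
  nonnegative, because \<open>\<bar>y\<bar> \<le> z\<close> gives \<open>y ^ k \<le> z ^ k\<close>.
  The term \<open>k = 1\<close> alone pays for the tangent correction, as \<open>X0 \<le> X\<close>.
  This lets an inner product be replaced by its Cauchy-Schwarz bound everywhere except in the linear
  term.\<close>

lemma power_tangent_mono:
  fixes X X0 y z :: real
  assumes "0 \<le> X0" "X0 \<le> X" "\<bar>y\<bar> \<le> z" "m \<ge> 1"
  shows "(X + y) ^ m - real m * X0 ^ (m - 1) * y \<le> (X + z) ^ m - real m * X0 ^ (m - 1) * z"
proof -
  have yz: "y \<le> z" "0 \<le> z" "0 \<le> X" using assms by linarith+
  have pw: "y ^ k \<le> z ^ k" for k
    by (metis abs_ge_self abs_ge_zero assms(3) order_trans power_abs power_mono)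
  define h where "h k = real (m choose k) * (z ^ k - y ^ k) * X ^ (m - k)" for k
  have "real m * X0 ^ (m - 1) * (z - y) \<le> h 1"
    unfolding h_def using assms yz
    by (simp add: mult.commute mult.left_commute mult_left_mono power_mono)
  also have "h 1 \<le> (\<Sum>k\<le>m. h k)"
    by (rule member_le_sum) (use assms pw yz in \<open>auto simp: h_def\<close>)
  also have "\<dots> = (z + X) ^ m - (y + X) ^ m"
    unfolding binomial_ring h_def by (simp add: sum_subtractf algebra_simps)
  finally show ?thesis by (simp add: algebra_simps)
qed

text \<open>Compare \<open>(1 + \<rho>) ^ q\<close> with \<open>exp (q * \<rho>)\<close>, which is
  at most \<open>2 + q * \<rho>\<close> on the unit interval, and remove the terms of order zero and
  one.\<close>

lemma binomial_tail_le_1: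
  fixes \<rho> :: real
  assumes "0 \<le> \<rho>" "real q * \<rho> \<le> 1"
  shows "(\<Sum>j=2..q. real (q choose j) * \<rho> ^ j) \<le> 1"
proof (cases "q \<ge> 2")
  case True
  have "(1 + \<rho>) ^ q \<le> exp \<rho> ^ q"
    using assms by (intro power_mono) auto
  also have "\<dots> = exp (real q * \<rho>)"
    by (simp add: exp_of_nat_mult)
  also have "\<dots> \<le> 1 + real q * \<rho> + (real q * \<rho>)\<^sup>2"
    using assms by (intro exp_bound) auto
  also have "\<dots> \<le> 1 + real q * \<rho> + 1"
    using assms by (simp add: power_le_one)
  finally have "(1 + \<rho>) ^ q \<le> 2 + real q * \<rho>" by simp
  moreover have "(1 + \<rho>) ^ q = (\<Sum>j\<le>q. real (q choose j) * \<rho> ^ j)"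
    using binomial_ring[of \<rho> 1 q] by (simp add: add.commute)
  moreover have "\<dots> = 1 + real q * \<rho> + (\<Sum>j=2..q. real (q choose j) * \<rho> ^ j)"
  proof -
    have "{..q} = insert 0 (insert 1 {2..q})" using True by auto
    then show ?thesis by simp
  qed
  ultimately show ?thesis by linarith
qed auto

text \<open>Each term of order at least two contains \<open>G\<^sup>2\<close>. What remains of it is
  a monomial of degree \<open>q - 2\<close> in \<open>A\<close> and \<open>G\<close>, at most
  \<open>max A t ^ (q - 2)\<close>, and the coefficients sum to at most one. The bound
  \<open>t\<close> is separate from \<open>G\<close> so that it can later be uniform over the values
  at a site.\<close>

lemma power_add_second_order_le:
  fixes A G t \<rho> :: real
  assumes "0 \<le> A" "0 \<le> G" "G \<le> t" "0 \<le> \<rho>" "real q * \<rho> \<le> 1" "2 \<le> q"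
  shows "(A + \<rho> * G) ^ q \<le> A ^ q + real q * A ^ (q - 1) * (\<rho> * G) + G\<^sup>2 * (A ^ (q - 2) + t ^ (q - 2))"
proof -
  have t: "0 \<le> t" using assms by linarith
  have "{..q} = insert 0 (insert 1 {2..q})" using assms by auto
  then have "(A + \<rho> * G) ^ q = A ^ q + real q * A ^ (q - 1) * (\<rho> * G)
      + (\<Sum>j=2..q. real (q choose j) * (\<rho> * G) ^ j * A ^ (q - j))"
    using binomial_ring[of "\<rho> * G" A q] by (simp add: algebra_simps)
  also have "(\<Sum>j=2..q. real (q choose j) * (\<rho> * G) ^ j * A ^ (q - j))
      \<le> (\<Sum>j=2..q. (real (q choose j) * \<rho> ^ j) * (G\<^sup>2 * (A ^ (q - 2) + t ^ (q - 2))))"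
  proof (rule sum_mono)
    fix j assume j: "j \<in> {2..q}"
    then obtain i where i: "j = 2 + i" by (metis atLeastAtMost_iff le_iff_add)
    then have qe: "q - 2 = i + (q - j)" using j by auto
    define M where "M = max A t"
    have "G ^ i * A ^ (q - j) \<le> M ^ i * M ^ (q - j)"
      by (intro mult_mono power_mono) (use assms t in \<open>auto simp: M_def\<close>)
    also have "\<dots> = M ^ (q - 2)" by (simp add: qe power_add)
    also have "\<dots> \<le> A ^ (q - 2) + t ^ (q - 2)"
      unfolding M_def max_def using assms t by auto
    finally have *: "G ^ i * A ^ (q - j) \<le> A ^ (q - 2) + t ^ (q - 2)" .
    have "real (q choose j) * (\<rho> * G) ^ j * A ^ (q - j) =
        (real (q choose j) * \<rho> ^ j) * (G\<^sup>2 * (G ^ i * A ^ (q - j)))"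
      by (simp add: i power_mult_distrib power_add power2_eq_square)
    also have "\<dots> \<le> (real (q choose j) * \<rho> ^ j) * (G\<^sup>2 * (A ^ (q - 2) + t ^ (q - 2)))"
      by (intro mult_left_mono *) (use assms in auto)
    finally show "real (q choose j) * (\<rho> * G) ^ j * A ^ (q - j) \<le> \<dots>" .
  qed
  also have "\<dots> = (\<Sum>j=2..q. real (q choose j) * \<rho> ^ j) * (G\<^sup>2 * (A ^ (q - 2) + t ^ (q - 2)))"
    by (simp add: sum_distrib_right)
  also have "\<dots> \<le> 1 * (G\<^sup>2 * (A ^ (q - 2) + t ^ (q - 2)))"
    by (intro mult_right_mono binomial_tail_le_1) (use assms t in auto)
  finally show ?thesis by simp
qed

text \<open>Here \<open>A\<close> and \<open>G\<close> are the norms of two vectors with inner product \<open>b\<close>, so the left side is a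
  power of the norm of their combination. The term linear in \<open>b\<close> is kept exact, to be averaged away.\<close>

lemma power_norm_add_le:
  fixes A G t \<rho> b :: real
  assumes "0 \<le> A" "0 \<le> G" "G \<le> t" "0 \<le> \<rho>" "real (2 * m) * \<rho> \<le> 1" "1 \<le> m"
    and "\<bar>b\<bar> \<le> A * G"
  shows "(A\<^sup>2 + 2 * \<rho> * b + \<rho>\<^sup>2 * G\<^sup>2) ^ m
    \<le> (A\<^sup>2) ^ m + real m * (A\<^sup>2) ^ (m - 1) * (2 * \<rho> * b) + G\<^sup>2 * ((A\<^sup>2) ^ (m - 1) + (t\<^sup>2) ^ (m - 1))"
proof -
  have "2 * m - 1 = Suc (2 * (m - 1))" "2 * m - 2 = 2 * (m - 1)" using assms by auto
  then have ex: "A ^ (2 * m) = (A\<^sup>2) ^ m" "A ^ (2 * m - 1) = A * (A\<^sup>2) ^ (m - 1)"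
    "z ^ (2 * m - 2) = (z\<^sup>2) ^ (m - 1)" for z :: real
    by (simp_all only: power_Suc power_mult)
  have "\<bar>2 * \<rho> * b\<bar> \<le> 2 * \<rho> * (A * G)"
    using assms by (simp add: abs_mult mult_left_mono)
  then have "(A\<^sup>2 + \<rho>\<^sup>2 * G\<^sup>2 + 2 * \<rho> * b) ^ m - real m * (A\<^sup>2) ^ (m - 1) * (2 * \<rho> * b)
      \<le> (A\<^sup>2 + \<rho>\<^sup>2 * G\<^sup>2 + 2 * \<rho> * (A * G)) ^ m - real m * (A\<^sup>2) ^ (m - 1) * (2 * \<rho> * (A * G))"
    by (intro power_tangent_mono) (use assms in auto)
  also have "A\<^sup>2 + \<rho>\<^sup>2 * G\<^sup>2 + 2 * \<rho> * (A * G) = (A + \<rho> * G)\<^sup>2"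
    by (simp add: power2_eq_square algebra_simps)
  also have "((A + \<rho> * G)\<^sup>2) ^ m = (A + \<rho> * G) ^ (2 * m)"
    by (simp add: power_mult)
  also have "\<dots> \<le> A ^ (2 * m) + real (2 * m) * A ^ (2 * m - 1) * (\<rho> * G)
      + G\<^sup>2 * (A ^ (2 * m - 2) + t ^ (2 * m - 2))"
    by (rule power_add_second_order_le) (use assms in auto)
  finally show ?thesis
    unfolding ex by (simp add: algebra_simps)
qed

text \<open>The term \<open>A ^ (m - 1) * s\<close> produced by the second-order bound is absorbed
  into \<open>(A + s) ^ m\<close> in this way.\<close>

lemma power_add_ge_tangent:
  fixes x y :: real
  assumes "0 \<le> x" "0 \<le> y" "1 \<le> m"
  shows "x ^ m + x ^ (m - 1) * y \<le> (x + y) ^ m"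
proof -
  obtain k where k: "m = Suc k" using assms by (cases m) auto
  have "x ^ k * (x + y) \<le> (x + y) ^ k * (x + y)"
    by (intro mult_right_mono power_mono) (use assms in auto)
  then show ?thesis by (simp add: k algebra_simps)
qed

lemma weighted_Cauchy_Schwarz:
  fixes w x y :: "'b \<Rightarrow> real"
  assumes "\<And>k. k \<in> K \<Longrightarrow> 0 \<le> w k"
  shows "\<bar>\<Sum>k\<in>K. w k * (x k * y k)\<bar> \<le> sqrt (\<Sum>k\<in>K. w k * (x k)\<^sup>2) * sqrt (\<Sum>k\<in>K. w k * (y k)\<^sup>2)"
proof -
  have e: "(\<Sum>k\<in>K. w k * (z k)\<^sup>2) = (\<Sum>k\<in>K. (sqrt (w k) * z k)\<^sup>2)" for z :: "'b \<Rightarrow> real"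
    by (rule sum.cong) (use assms in \<open>auto simp: power_mult_distrib\<close>)
  have "\<bar>\<Sum>k\<in>K. w k * (x k * y k)\<bar> \<le> (\<Sum>k\<in>K. \<bar>w k * (x k * y k)\<bar>)"
    by (rule sum_abs)
  also have "\<dots> = (\<Sum>k\<in>K. \<bar>sqrt (w k) * x k\<bar> * \<bar>sqrt (w k) * y k\<bar>)"
  proof (rule sum.cong)
    fix k assume "k \<in> K"
    then have "w k = sqrt (w k) * sqrt (w k)" using assms by simp
    then show "\<bar>w k * (x k * y k)\<bar> = \<bar>sqrt (w k) * x k\<bar> * \<bar>sqrt (w k) * y k\<bar>"
      by (metis abs_mult mult.assoc mult.left_commute)
  qed simp
  also have "\<dots> \<le> L2_set (\<lambda>k. sqrt (w k) * x k) K * L2_set (\<lambda>k. sqrt (w k) * y k) K"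
    by (rule L2_set_mult_ineq)
  finally show ?thesis unfolding e L2_set_def .
qed

lemma expectation_finite:
  fixes f :: "'a \<Rightarrow> real"
  assumes "finite (set_pmf M)"
  shows "measure_pmf.expectation M f = (\<Sum>a\<in>set_pmf M. pmf M a * f a)"
  using integral_measure_pmf[OF assms, of M f] by simp

text \<open>Here \<open>u\<close> is the averaged vector, \<open>v a\<close> its deviation at the
  letter \<open>a\<close>, and \<open>s\<close> the mean squared norm of the deviation. The lower
  bound \<open>\<delta>\<close> on the atoms serves to control the deviation pointwise by its
  mean.\<close>

lemma single_site_inequality:
  fixes M :: "'a pmf" and w u :: "'b \<Rightarrow> real" and v :: "'a \<Rightarrow> 'b \<Rightarrow> real"
  assumes fin: "finite (set_pmf M)" "finite K" and w: "\<And>k. k \<in> K \<Longrightarrow> 0 \<le> w k"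
    and \<delta>: "0 < \<delta>" "\<And>a. a \<in> set_pmf M \<Longrightarrow> \<delta> \<le> pmf M a"
    and mean: "\<And>k. k \<in> K \<Longrightarrow> (\<Sum>a\<in>set_pmf M. pmf M a * v a k) = 0"
    and \<rho>: "0 \<le> \<rho>" "real (2 * m) * \<rho> \<le> 1" and m: "1 \<le> m"
  defines "A \<equiv> \<Sum>k\<in>K. w k * (u k)\<^sup>2"
    and "s \<equiv> \<Sum>a\<in>set_pmf M. \<Sum>k\<in>K. pmf M a * w k * (v a k)\<^sup>2"
  shows "(\<Sum>a\<in>set_pmf M. pmf M a * (\<Sum>k\<in>K. w k * (u k + \<rho> * v a k)\<^sup>2) ^ m)
    \<le> (A + s) ^ m + (1 / \<delta>) ^ (m - 1) * s ^ m"
proof -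
  define G where "G a = (\<Sum>k\<in>K. w k * (v a k)\<^sup>2)" for a
  define b where "b a = (\<Sum>k\<in>K. w k * (u k * v a k))" for a
  have A0: "0 \<le> A" and G0: "0 \<le> G a" for a
    unfolding A_def G_def using w by (auto intro!: sum_nonneg)
  have s: "s = (\<Sum>a\<in>set_pmf M. pmf M a * G a)"
    unfolding s_def G_def by (simp add: sum_distrib_left mult.assoc)
  then have s0: "0 \<le> s" using G0 by (auto intro!: sum_nonneg)
  \<comment> \<open>A single atom of mass at least \<open>\<delta>\<close> already contributes
    \<open>\<delta> * G a\<close> to \<open>s\<close>.\<close>
  have Gs: "G a \<le> s / \<delta>" if "a \<in> set_pmf M" for a
  proof -
    have "\<delta> * G a \<le> pmf M a * G a" using that \<delta> G0 by (intro mult_right_mono) auto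
    also have "\<dots> \<le> s" unfolding s by (rule member_le_sum) (use that fin G0 in auto)
    finally show ?thesis using \<delta> by (simp add: field_simps)
  qed
  \<comment> \<open>This is the scalar estimate with \<open>t = sqrt (s / \<delta>)\<close>, which
    does not depend on \<open>a\<close>.\<close>
  have pt: "(\<Sum>k\<in>K. w k * (u k + \<rho> * v a k)\<^sup>2) ^ m \<le>
      A ^ m + real m * A ^ (m - 1) * (2 * \<rho> * b a) + G a * (A ^ (m - 1) + (s / \<delta>) ^ (m - 1))"
    if a: "a \<in> set_pmf M" for a
  proof -
    have "(\<Sum>k\<in>K. w k * (u k + \<rho> * v a k)\<^sup>2) = A + 2 * \<rho> * b a + \<rho>\<^sup>2 * G a"
      unfolding A_def b_def G_def
      by (simp add: sum_distrib_left flip: sum.distrib)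
        (simp add: power2_eq_square algebra_simps)
    moreover have "\<bar>b a\<bar> \<le> sqrt A * sqrt (G a)"
      unfolding b_def A_def G_def by (rule weighted_Cauchy_Schwarz) (use w in auto)
    ultimately show ?thesis
      using power_norm_add_le[of "sqrt A" "sqrt (G a)" "sqrt (s / \<delta>)" \<rho> m "b a"]
        A0 G0 s0 \<delta> \<rho> m Gs[OF a] by simp
  qed
  have b0: "(\<Sum>a\<in>set_pmf M. pmf M a * b a) = 0"
  proof -
    have "(\<Sum>a\<in>set_pmf M. pmf M a * b a) = (\<Sum>k\<in>K. w k * u k * (\<Sum>a\<in>set_pmf M. pmf M a * v a k))"
      unfolding b_def sum_distrib_left
      by (subst sum.swap) (simp add: algebra_simps)
    then show ?thesis using mean by simp
  qed
  have one: "(\<Sum>a\<in>set_pmf M. pmf M a) = 1"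
    using sum_pmf_eq_1[of "set_pmf M" M] fin by simp
  have "(\<Sum>a\<in>set_pmf M. pmf M a * (\<Sum>k\<in>K. w k * (u k + \<rho> * v a k)\<^sup>2) ^ m) \<le>
      (\<Sum>a\<in>set_pmf M. pmf M a * (A ^ m + real m * A ^ (m - 1) * (2 * \<rho> * b a)
        + G a * (A ^ (m - 1) + (s / \<delta>) ^ (m - 1))))"
    by (intro sum_mono mult_left_mono pt) auto
  also have "\<dots> = (\<Sum>a\<in>set_pmf M. A ^ m * pmf M a + real m * A ^ (m - 1) * 2 * \<rho> * (pmf M a * b a)
      + (A ^ (m - 1) + (s / \<delta>) ^ (m - 1)) * (pmf M a * G a))"
    by (simp add: algebra_simps)
  also have "\<dots> = A ^ m * (\<Sum>a\<in>set_pmf M. pmf M a)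
      + real m * A ^ (m - 1) * 2 * \<rho> * (\<Sum>a\<in>set_pmf M. pmf M a * b a)
      + (A ^ (m - 1) + (s / \<delta>) ^ (m - 1)) * s"
    by (simp only: sum.distrib sum_distrib_left s)
  \<comment> \<open>The remaining factor \<open>s\<close> turns
    \<open>(s / \<delta>) ^ (m - 1)\<close> into
    \<open>(1 / \<delta>) ^ (m - 1) * s ^ m\<close>.\<close>
  also have "\<dots> = (A ^ m + A ^ (m - 1) * s) + (1 / \<delta>) ^ (m - 1) * s ^ m"
    using b0 one m by (cases m) (auto simp: algebra_simps power_divide)
  also have "\<dots> \<le> (A + s) ^ m + (1 / \<delta>) ^ (m - 1) * s ^ m"
    using power_add_ge_tangent[OF A0 s0 m] by simp
  finally show ?thesis .
qed

subsection \<open>Efron-Stein components and one coordinate\<close>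

definition site_avg :: "('i \<Rightarrow> 'a pmf) \<Rightarrow> 'i \<Rightarrow> (('i \<Rightarrow> 'a) \<Rightarrow> real) \<Rightarrow> ('i \<Rightarrow> 'a) \<Rightarrow> real" where
  "site_avg \<nu> i f x = (\<Sum>a\<in>set_pmf (\<nu> i). pmf (\<nu> i) a * f (x(i := a)))"

text \<open>The letter \<open>a\<close> is a parameter and not read off from \<open>x\<close>, so
  that each \<open>a\<close> gives a function of the remaining coordinates. These functions are the
  components of the vector-valued \<open>g\<close>.\<close>

definition site_dev ::
  "('i \<Rightarrow> 'a pmf) \<Rightarrow> 'i \<Rightarrow> (('i \<Rightarrow> 'a) \<Rightarrow> real) \<Rightarrow> 'a \<Rightarrow> ('i \<Rightarrow> 'a) \<Rightarrow> real" where
  "site_dev \<nu> i f a x = f (x(i := a)) - site_avg \<nu> i f x"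

text \<open>A common form of the noise operator (\<open>c S = \<rho> ^ card S\<close>) and the
  Laplacian (\<open>c S = of_bool (T \<subseteq> S)\<close>), so that linearity and the splitting at
  one coordinate are proved once.\<close>

definition es_multiplier ::
  "'i set \<Rightarrow> ('i \<Rightarrow> 'a pmf) \<Rightarrow> ('i set \<Rightarrow> real) \<Rightarrow> (('i \<Rightarrow> 'a) \<Rightarrow> real) \<Rightarrow> ('i \<Rightarrow> 'a) \<Rightarrow> real" where
  "es_multiplier I \<nu> c f x = (\<Sum>S\<in>Pow I. c S * efron_stein I \<nu> S f x)"

section \<open>Expectations over the product\<close>

lemma finite_set_prod_space:
  assumes "finite I" "\<forall>t\<in>I. finite (set_pmf (\<nu> t))"
  shows "finite (set_pmf (prod_space I \<nu>))"
  unfolding prod_space_def using assms by (simp add: set_Pi_pmf finite_PiE_dflt)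

lemma expectation_prod_space_insert:
  fixes f :: "('i \<Rightarrow> 'a) \<Rightarrow> real"
  assumes "finite I" "i \<notin> I" "\<forall>t\<in>insert i I. finite (set_pmf (\<nu> t))"
  shows "measure_pmf.expectation (prod_space (insert i I) \<nu>) f =
    measure_pmf.expectation (prod_space I \<nu>) (site_avg \<nu> i f)"
proof -
  have fin: "finite (set_pmf (prod_space I \<nu>))" "finite (set_pmf (\<nu> i))"
    using assms by (auto intro!: finite_set_prod_space)
  have "prod_space (insert i I) \<nu> = map_pmf (\<lambda>(a, y). y(i := a)) (pair_pmf (\<nu> i) (prod_space I \<nu>))"
    unfolding prod_space_def using assms by (simp add: Pi_pmf_insert)
  then have "measure_pmf.expectation (prod_space (insert i I) \<nu>) f =
      measure_pmf.expectation (pair_pmf (\<nu> i) (prod_space I \<nu>)) (\<lambda>(a, y). f (y(i := a)))"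
    by (simp add: case_prod_unfold)
  also have "\<dots> = (\<Sum>a\<in>set_pmf (\<nu> i). \<Sum>y\<in>set_pmf (prod_space I \<nu>).
      pmf (\<nu> i) a * pmf (prod_space I \<nu>) y * f (y(i := a)))"
    using fin by (auto simp: expectation_finite sum.cartesian_product pmf_pair case_prod_unfold intro!: sum.cong)
  also have "\<dots> = measure_pmf.expectation (prod_space I \<nu>) (site_avg \<nu> i f)"
    using fin by (subst sum.swap) (simp add: expectation_finite site_avg_def sum_distrib_left algebra_simps)
  finally show ?thesis .
qed

section \<open>Conditional averages\<close>

lemma avg_outside_cong:
  assumes "\<And>t. t \<in> J \<Longrightarrow> x t = y t"
  shows "avg_outside I \<nu> J f x = avg_outside I \<nu> J f y"
proof -
  have "merge J (I - J) (x, z) = merge J (I - J) (y, z)" for z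
    using assms by (auto simp: merge_def fun_eq_iff)
  then show ?thesis unfolding avg_outside_def by simp
qed

lemma avg_outside_sum:
  assumes "finite I" "\<forall>t\<in>I. finite (set_pmf (\<nu> t))"
  shows "avg_outside I \<nu> J (\<lambda>y. \<Sum>k\<in>K. c k * F k y) x = (\<Sum>k\<in>K. c k * avg_outside I \<nu> J (F k) x)"
proof -
  have "finite (set_pmf (prod_space (I - J) \<nu>))"
    using assms by (intro finite_set_prod_space) auto
  then show ?thesis
    unfolding avg_outside_def
    by (simp add: expectation_finite sum_distrib_left) (subst sum.swap, simp add: algebra_simps)
qed

lemma avg_outside_insert_mem:
  assumes "i \<notin> I" "J \<subseteq> I"
  shows "avg_outside (insert i I) \<nu> (insert i J) f x = avg_outside I \<nu> J (\<lambda>y. f (y(i := x i))) x"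
proof -
  have "insert i I - insert i J = I - J" using assms by auto
  moreover have "merge (insert i J) (I - J) (x, y) = (merge J (I - J) (x, y))(i := x i)" for y
    using assms by (auto simp: merge_def fun_eq_iff)
  ultimately show ?thesis unfolding avg_outside_def by simp
qed

lemma avg_outside_insert_notin:
  assumes "finite I" "i \<notin> I" "\<forall>t\<in>insert i I. finite (set_pmf (\<nu> t))" "J \<subseteq> I"
  shows "avg_outside (insert i I) \<nu> J f x = avg_outside I \<nu> J (site_avg \<nu> i f) x"
proof -
  have e: "insert i I - J = insert i (I - J)" using assms by auto
  have m: "merge J (insert i (I - J)) (x, y(i := a)) = (merge J (I - J) (x, y))(i := a)" for y a
    using assms by (auto simp: merge_def fun_eq_iff)
  show ?thesis
    unfolding avg_outside_def e
    by (subst expectation_prod_space_insert) (use assms in \<open>auto simp: site_avg_def[abs_def] m\<close>)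
qed

section \<open>Efron-Stein components\<close>

lemma efron_stein_cong:
  assumes "\<And>t. t \<in> S \<Longrightarrow> x t = y t"
  shows "efron_stein I \<nu> S f x = efron_stein I \<nu> S f y"
  unfolding efron_stein_def using assms
  by (intro sum.cong refl arg_cong2[of _ _ _ _ "(*)"] avg_outside_cong) auto

lemma efron_stein_sum:
  assumes "finite I" "\<forall>t\<in>I. finite (set_pmf (\<nu> t))"
  shows "efron_stein I \<nu> S (\<lambda>y. \<Sum>k\<in>K. c k * F k y) x = (\<Sum>k\<in>K. c k * efron_stein I \<nu> S (F k) x)"
proof -
  have "efron_stein I \<nu> S (\<lambda>y. \<Sum>k\<in>K. c k * F k y) x =
      (\<Sum>J\<in>Pow S. \<Sum>k\<in>K. c k * ((- 1) ^ card (S - J) * avg_outside I \<nu> J (F k) x))"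
    unfolding efron_stein_def
    by (simp add: avg_outside_sum[OF assms] sum_distrib_left mult.left_commute)
  also have "\<dots> = (\<Sum>k\<in>K. c k * efron_stein I \<nu> S (F k) x)"
    unfolding efron_stein_def sum_distrib_left by (rule sum.swap)
  finally show ?thesis .
qed

lemma efron_stein_diff:
  assumes "finite I" "\<forall>t\<in>I. finite (set_pmf (\<nu> t))"
  shows "efron_stein I \<nu> S (\<lambda>y. f y - g y) x = efron_stein I \<nu> S f x - efron_stein I \<nu> S g x"
  \<comment> \<open>The difference is a two-term sum indexed by the booleans.\<close>
  using efron_stein_sum[OF assms, where K = UNIV and c = "\<lambda>b. if b then 1 else -1"
      and F = "\<lambda>b. if b then f else g" and S = S and x = x]
  by (simp add: UNIV_bool)

lemma sum_Pow_insert: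
  assumes "finite I" "i \<notin> I"
  shows "(\<Sum>S\<in>Pow (insert i I). h S) = (\<Sum>S\<in>Pow I. h S) + (\<Sum>S\<in>Pow I. h (insert i S))"
proof -
  have "inj_on (insert i) (Pow I)"
    using assms by (auto intro!: inj_onI simp: insert_ident)
  moreover have "Pow I \<inter> insert i ` Pow I = {}" using assms by auto
  ultimately show ?thesis
    using assms by (simp add: Pow_insert sum.union_disjoint sum.reindex)
qed

lemma efron_stein_insert_notin:
  assumes "finite I" "i \<notin> I" "\<forall>t\<in>insert i I. finite (set_pmf (\<nu> t))" "S \<subseteq> I"
  shows "efron_stein (insert i I) \<nu> S f x = efron_stein I \<nu> S (site_avg \<nu> i f) x"
  unfolding efron_stein_def
  by (intro sum.cong refl arg_cong2[of _ _ _ _ "(*)"] avg_outside_insert_notin) (use assms in auto)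

text \<open>The subsets of \<open>insert i S\<close> come in pairs \<open>J\<close>,
  \<open>insert i J\<close> with opposite signs. The second freezes coordinate \<open>i\<close> at
  \<open>x i\<close>, the first averages over it, and the difference is the deviation.\<close>

lemma efron_stein_insert_mem:
  assumes "finite I" "i \<notin> I" "\<forall>t\<in>insert i I. finite (set_pmf (\<nu> t))" "S \<subseteq> I"
  shows "efron_stein (insert i I) \<nu> (insert i S) f x = efron_stein I \<nu> S (site_dev \<nu> i f (x i)) x"
proof -
  have S: "finite S" "i \<notin> S" using assms finite_subset by auto
  have 1: "(- 1) ^ card (insert i S - J) * avg_outside (insert i I) \<nu> J f x =
      - ((- 1) ^ card (S - J) * avg_outside I \<nu> J (site_avg \<nu> i f) x)" if "J \<in> Pow S" for J
  proof -
    have "insert i S - J = insert i (S - J)" using that S by auto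
    then show ?thesis using that S assms by (subst avg_outside_insert_notin) auto
  qed
  have 2: "(- 1) ^ card (insert i S - insert i J) * avg_outside (insert i I) \<nu> (insert i J) f x =
      (- 1) ^ card (S - J) * avg_outside I \<nu> J (\<lambda>y. f (y(i := x i))) x" if "J \<in> Pow S" for J
  proof -
    have "insert i S - insert i J = S - J" using that S by auto
    then show ?thesis using that S assms by (subst avg_outside_insert_mem) auto
  qed
  note sums = sum.cong[OF refl 1, of "Pow S"] sum.cong[OF refl 2, of "Pow S"]
  have "efron_stein (insert i I) \<nu> (insert i S) f x =
      efron_stein I \<nu> S (\<lambda>y. f (y(i := x i))) x - efron_stein I \<nu> S (site_avg \<nu> i f) x"
    unfolding efron_stein_def sum_Pow_insert[OF S] by (simp only: sums sum_negf)
  also have "\<dots> = efron_stein I \<nu> S (site_dev \<nu> i f (x i)) x"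
    unfolding site_dev_def[abs_def] by (subst efron_stein_diff) (use assms in auto)
  finally show ?thesis .
qed

section \<open>Multipliers of the Efron-Stein decomposition\<close>

lemma es_multiplier_insert:
  assumes "finite I" "i \<notin> I" "\<forall>t\<in>insert i I. finite (set_pmf (\<nu> t))"
  shows "es_multiplier (insert i I) \<nu> c f x = es_multiplier I \<nu> c (site_avg \<nu> i f) x
    + es_multiplier I \<nu> (\<lambda>S. c (insert i S)) (site_dev \<nu> i f (x i)) x"
  unfolding es_multiplier_def sum_Pow_insert[OF assms(1,2)]
  by (intro arg_cong2[of _ _ _ _ "(+)"] arg_cong2[of _ _ _ _ "(*)"] sum.cong refl
      efron_stein_insert_notin efron_stein_insert_mem) (use assms in auto)

lemma es_multiplier_cong_coeff:
  assumes "\<And>S. S \<subseteq> I \<Longrightarrow> c S = d S"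
  shows "es_multiplier I \<nu> c f x = es_multiplier I \<nu> d f x"
  unfolding es_multiplier_def using assms by (auto intro!: sum.cong)

lemma es_multiplier_upd:
  assumes "i \<notin> I"
  shows "es_multiplier I \<nu> c f (x(i := a)) = es_multiplier I \<nu> c f x"
  unfolding es_multiplier_def
  by (intro sum.cong refl arg_cong2[of _ _ _ _ "(*)"] efron_stein_cong) (use assms in auto)

lemma es_multiplier_sum:
  assumes "finite I" "\<forall>t\<in>I. finite (set_pmf (\<nu> t))"
  shows "es_multiplier I \<nu> c (\<lambda>y. \<Sum>k\<in>K. d k * F k y) x = (\<Sum>k\<in>K. d k * es_multiplier I \<nu> c (F k) x)"
proof -
  have "es_multiplier I \<nu> c (\<lambda>y. \<Sum>k\<in>K. d k * F k y) x =
      (\<Sum>S\<in>Pow I. \<Sum>k\<in>K. d k * (c S * efron_stein I \<nu> S (F k) x))"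
    unfolding es_multiplier_def
    by (simp add: efron_stein_sum[OF assms] sum_distrib_left mult.left_commute)
  also have "\<dots> = (\<Sum>k\<in>K. d k * es_multiplier I \<nu> c (F k) x)"
    unfolding es_multiplier_def sum_distrib_left by (rule sum.swap)
  finally show ?thesis .
qed

lemma es_multiplier_scale:
  "es_multiplier I \<nu> (\<lambda>S. r * c S) f x = r * es_multiplier I \<nu> c f x"
  unfolding es_multiplier_def by (simp add: sum_distrib_left mult.assoc)

lemma site_dev_mean:
  assumes "finite (set_pmf (\<nu> i))"
  shows "(\<Sum>a\<in>set_pmf (\<nu> i). pmf (\<nu> i) a * site_dev \<nu> i f a x) = 0"
proof -
  have "(\<Sum>a\<in>set_pmf (\<nu> i). pmf (\<nu> i) a) = 1"
    using sum_pmf_eq_1[of "set_pmf (\<nu> i)" "\<nu> i"] assms by simp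
  then show ?thesis
    by (simp add: site_dev_def right_diff_distrib sum_subtractf site_avg_def flip: sum_distrib_right)
qed

lemma es_multiplier_site_dev_mean:
  assumes "finite I" "\<forall>t\<in>insert i I. finite (set_pmf (\<nu> t))"
  shows "(\<Sum>a\<in>set_pmf (\<nu> i). pmf (\<nu> i) a * es_multiplier I \<nu> c (site_dev \<nu> i f a) x) = 0"
proof -
  have "(\<Sum>a\<in>set_pmf (\<nu> i). pmf (\<nu> i) a * es_multiplier I \<nu> c (site_dev \<nu> i f a) x)
      = es_multiplier I \<nu> c (\<lambda>y. \<Sum>a\<in>set_pmf (\<nu> i). pmf (\<nu> i) a * site_dev \<nu> i f a y) x"
    using assms by (subst es_multiplier_sum) auto
  \<comment> \<open>The zero function is written as an empty sum, so that linearity also shows that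
    its image is zero.\<close>
  also have "\<dots> = es_multiplier I \<nu> c (\<lambda>y. \<Sum>a\<in>({} :: nat set). 0 * f y) x"
    using assms by (subst site_dev_mean) auto
  also have "\<dots> = 0"
    using assms by (subst es_multiplier_sum) auto
  finally show ?thesis .
qed

section \<open>The noise operator and the Laplacians as multipliers\<close>

lemma laplacian_eq_es_multiplier:
  assumes "finite I"
  shows "laplacian I \<nu> T f x = es_multiplier I \<nu> (\<lambda>S. of_bool (T \<subseteq> S)) f x"
proof -
  have "{S. T \<subseteq> S \<and> S \<subseteq> I} = {S \<in> Pow I. T \<subseteq> S}" by auto
  then show ?thesis
    unfolding laplacian_def es_multiplier_def using assms
    by (intro sum.mono_neutral_cong_left) auto
qed

lemma noise_op_eq_es_multiplier: "noise_op I \<nu> \<rho> f x = es_multiplier I \<nu> (\<lambda>S. \<rho> ^ card S) f x"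
  unfolding noise_op_def es_multiplier_def ..

text \<open>Components containing \<open>i\<close> carry exactly one extra factor
  \<open>\<rho>\<close>. This is the shape \<open>u + \<rho> * v a\<close> of the one-site
  inequality.\<close>

lemma noise_op_insert:
  assumes "finite I" "i \<notin> I" "\<forall>t\<in>insert i I. finite (set_pmf (\<nu> t))"
  shows "noise_op (insert i I) \<nu> \<rho> f (x(i := a)) =
    noise_op I \<nu> \<rho> (site_avg \<nu> i f) x + \<rho> * noise_op I \<nu> \<rho> (site_dev \<nu> i f a) x"
proof -
  have "\<rho> ^ card (insert i S) = \<rho> * \<rho> ^ card S" if "S \<subseteq> I" for S
    using that assms finite_subset by (subst card_insert_disjoint) auto
  then have "es_multiplier I \<nu> (\<lambda>S. \<rho> ^ card (insert i S)) g x =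
      es_multiplier I \<nu> (\<lambda>S. \<rho> * \<rho> ^ card S) g x" for g x
    by (rule es_multiplier_cong_coeff)
  then show ?thesis
    using assms unfolding noise_op_eq_es_multiplier
    by (simp add: es_multiplier_insert[OF assms(1-3)] es_multiplier_upd es_multiplier_scale)
qed

lemma laplacian_insert_notin:
  assumes "finite I" "i \<notin> I" "\<forall>t\<in>insert i I. finite (set_pmf (\<nu> t))" "T \<subseteq> I"
  shows "laplacian (insert i I) \<nu> T f (x(i := a)) =
    laplacian I \<nu> T (site_avg \<nu> i f) x + laplacian I \<nu> T (site_dev \<nu> i f a) x"
proof -
  have "T \<subseteq> insert i S \<longleftrightarrow> T \<subseteq> S" for S using assms by auto
  then show ?thesis
    using assms by (simp add: laplacian_eq_es_multiplier es_multiplier_insert[OF assms(1-3)] es_multiplier_upd)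
qed

text \<open>When \<open>i\<close> lies in the lower set, the components without \<open>i\<close>
  drop out, and with them the averaged part.\<close>

lemma laplacian_insert_mem:
  assumes "finite I" "i \<notin> I" "\<forall>t\<in>insert i I. finite (set_pmf (\<nu> t))" "T \<subseteq> I"
  shows "laplacian (insert i I) \<nu> (insert i T) f (x(i := a)) = laplacian I \<nu> T (site_dev \<nu> i f a) x"
proof -
  have "insert i T \<subseteq> insert i S \<longleftrightarrow> T \<subseteq> S" for S using assms by auto
  moreover have "es_multiplier I \<nu> (\<lambda>S. of_bool (insert i T \<subseteq> S)) g x = 0" for g x
    unfolding es_multiplier_def by (rule sum.neutral) (use assms in auto)
  ultimately show ?thesis
    using assms
    by (simp add: laplacian_eq_es_multiplier es_multiplier_insert[OF assms(1-3)] es_multiplier_upd)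
qed

section \<open>Second moments of the Laplacians\<close>

lemma expectation_prod_space_sum:
  fixes F :: "'k \<Rightarrow> ('i \<Rightarrow> 'a) \<Rightarrow> real"
  assumes "finite I" "\<forall>t\<in>I. finite (set_pmf (\<nu> t))"
  shows "measure_pmf.expectation (prod_space I \<nu>) (\<lambda>y. \<Sum>k\<in>K. c k * F k y) =
    (\<Sum>k\<in>K. c k * measure_pmf.expectation (prod_space I \<nu>) (F k))"
proof -
  have "integrable (measure_pmf (prod_space I \<nu>)) g" for g :: "_ \<Rightarrow> real"
    using assms by (intro integrable_measure_pmf_finite finite_set_prod_space) auto
  then show ?thesis by simp
qed

text \<open>Pythagoras: the cross term vanishes because the deviation has mean zero at site
  \<open>i\<close>. Being an equality, it identifies the mass given by the induction hypothesis for
  \<open>(T f\<^sub>0, T g)\<close> with that of the Laplacian on the larger product.\<close>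

lemma expectation_laplacian_sq_insert_notin:
  assumes "finite I" "i \<notin> I" "\<forall>t\<in>insert i I. finite (set_pmf (\<nu> t))" "T \<subseteq> I"
  shows "measure_pmf.expectation (prod_space (insert i I) \<nu>) (\<lambda>x. (laplacian (insert i I) \<nu> T f x)\<^sup>2) =
    measure_pmf.expectation (prod_space I \<nu>) (\<lambda>x. (laplacian I \<nu> T (site_avg \<nu> i f) x)\<^sup>2)
    + (\<Sum>a\<in>set_pmf (\<nu> i). pmf (\<nu> i) a
        * measure_pmf.expectation (prod_space I \<nu>) (\<lambda>x. (laplacian I \<nu> T (site_dev \<nu> i f a) x)\<^sup>2))"
proof -
  let ?P = "set_pmf (\<nu> i)" and ?p = "pmf (\<nu> i)"
  let ?u = "laplacian I \<nu> T (site_avg \<nu> i f)" and ?v = "\<lambda>a. laplacian I \<nu> T (site_dev \<nu> i f a)"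
  have one: "(\<Sum>a\<in>?P. ?p a) = 1"
    using sum_pmf_eq_1[of ?P "\<nu> i"] assms by simp
  have v0: "(\<Sum>a\<in>?P. ?p a * ?v a x) = 0" for x
    unfolding laplacian_eq_es_multiplier[OF assms(1)]
    using assms by (intro es_multiplier_site_dev_mean) auto
  have "site_avg \<nu> i (\<lambda>x. (laplacian (insert i I) \<nu> T f x)\<^sup>2) =
      (\<lambda>x. (?u x)\<^sup>2 + (\<Sum>a\<in>?P. ?p a * (?v a x)\<^sup>2))"
  proof
    fix x
    have "site_avg \<nu> i (\<lambda>x. (laplacian (insert i I) \<nu> T f x)\<^sup>2) x =
        (\<Sum>a\<in>?P. (?u x)\<^sup>2 * ?p a + 2 * ?u x * (?p a * ?v a x) + ?p a * (?v a x)\<^sup>2)"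
      unfolding site_avg_def[of _ _ "\<lambda>x. (laplacian (insert i I) \<nu> T f x)\<^sup>2"]
        laplacian_insert_notin[OF assms]
      by (intro sum.cong refl) (simp add: power2_eq_square algebra_simps)
    also have "\<dots> = (?u x)\<^sup>2 * (\<Sum>a\<in>?P. ?p a) + 2 * ?u x * (\<Sum>a\<in>?P. ?p a * ?v a x)
        + (\<Sum>a\<in>?P. ?p a * (?v a x)\<^sup>2)"
      by (simp only: sum.distrib sum_distrib_left)
    finally show "site_avg \<nu> i (\<lambda>x. (laplacian (insert i I) \<nu> T f x)\<^sup>2) x =
        (?u x)\<^sup>2 + (\<Sum>a\<in>?P. ?p a * (?v a x)\<^sup>2)"
      by (simp add: one v0)
  qed
  moreover have "integrable (measure_pmf (prod_space I \<nu>)) g" for g :: "_ \<Rightarrow> real"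
    using assms by (intro integrable_measure_pmf_finite finite_set_prod_space) auto
  ultimately show ?thesis
    using assms by (simp add: expectation_prod_space_insert)
qed

lemma expectation_laplacian_sq_insert_mem:
  assumes "finite I" "i \<notin> I" "\<forall>t\<in>insert i I. finite (set_pmf (\<nu> t))" "T \<subseteq> I"
  shows "measure_pmf.expectation (prod_space (insert i I) \<nu>)
      (\<lambda>x. (laplacian (insert i I) \<nu> (insert i T) f x)\<^sup>2) =
    (\<Sum>a\<in>set_pmf (\<nu> i). pmf (\<nu> i) a
        * measure_pmf.expectation (prod_space I \<nu>) (\<lambda>x. (laplacian I \<nu> T (site_dev \<nu> i f a) x)\<^sup>2))"
proof -
  have "site_avg \<nu> i (\<lambda>x. (laplacian (insert i I) \<nu> (insert i T) f x)\<^sup>2) =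
      (\<lambda>x. \<Sum>a\<in>set_pmf (\<nu> i). pmf (\<nu> i) a * (laplacian I \<nu> T (site_dev \<nu> i f a) x)\<^sup>2)"
    unfolding fun_eq_iff site_avg_def laplacian_insert_mem[OF assms] by simp
  then show ?thesis
    using assms by (simp add: expectation_prod_space_insert expectation_prod_space_sum)
qed

subsection \<open>Induction on the coordinates\<close>

text \<open>\<open>F\<close> is viewed as a vector-valued function with components \<open>F k\<close>, where component \<open>k\<close> has weight
  \<open>w k\<close> in the squared norm.\<close>

definition noise_moment_bound ::
  "'i set \<Rightarrow> ('i \<Rightarrow> 'a pmf) \<Rightarrow> ('i \<Rightarrow> real) \<Rightarrow> real \<Rightarrow> nat \<Rightarrow> 'k set \<Rightarrow> ('k \<Rightarrow> real)
    \<Rightarrow> ('k \<Rightarrow> ('i \<Rightarrow> 'a) \<Rightarrow> real) \<Rightarrow> bool" where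
  "noise_moment_bound I \<nu> \<delta> \<rho> m K w F \<longleftrightarrow>
    measure_pmf.expectation (prod_space I \<nu>) (\<lambda>x. (\<Sum>k\<in>K. w k * (noise_op I \<nu> \<rho> (F k) x)\<^sup>2) ^ m)
    \<le> (\<Sum>S\<in>Pow I. (\<Prod>t\<in>S. (1 / \<delta> t) ^ (m - 1)) *
        (\<Sum>k\<in>K. w k * measure_pmf.expectation (prod_space I \<nu>) (\<lambda>x. (laplacian I \<nu> S (F k) x)\<^sup>2)) ^ m)"

lemma noise_moment_bound_reindex:
  assumes "bij_betw h L K"
  shows "noise_moment_bound I \<nu> \<delta> \<rho> m L (w \<circ> h) (F \<circ> h) \<longleftrightarrow> noise_moment_bound I \<nu> \<delta> \<rho> m K w F"
  unfolding noise_moment_bound_def o_def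
  by (simp add: sum.reindex_bij_betw[OF assms, of "\<lambda>k. w k * (noise_op I \<nu> \<rho> (F k) _)\<^sup>2"]
      sum.reindex_bij_betw[OF assms, of "\<lambda>k. w k * measure_pmf.expectation (prod_space I \<nu>)
        (\<lambda>x. (laplacian I \<nu> _ (F k) x)\<^sup>2)"])

text \<open>The index type grows in the induction step, whereas an induction hypothesis has a fixed index
  type. Natural number indices suffice for all finite index sets.\<close>

lemma noise_moment_bound_nat_imp:
  assumes "\<And>w F. (\<And>k::nat. 0 \<le> w k) \<Longrightarrow> noise_moment_bound I \<nu> \<delta> \<rho> m {0..<card K} w F"
    and "finite K" "\<And>k. 0 \<le> w k"
  shows "noise_moment_bound I \<nu> \<delta> \<rho> m K w F"
proof -
  obtain h where "bij_betw h {0..<card K} K"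
    using ex_bij_betw_nat_finite[OF assms(2)] by blast
  then show ?thesis
    using assms(1)[of "w \<circ> h" "F \<circ> h"] assms(3) by (simp add: noise_moment_bound_reindex)
qed

text \<open>The hypothesis for \<open>I\<close> is used for two vector-valued functions: the pair of
  averaged part and deviation, indexed by \<open>N \<union> D\<close>, and the deviation alone,
  indexed by \<open>D\<close>. Hence it is assumed for the enlarged index type
  \<open>'a option \<times> 'k\<close>.\<close>

lemma noise_moment_bound_insert:
  fixes K :: "'k set" and \<nu> :: "'i \<Rightarrow> 'a pmf"
  assumes I: "finite I" "i \<notin> I" "\<forall>t\<in>insert i I. finite (set_pmf (\<nu> t))"
    and \<delta>: "\<And>t. t \<in> insert i I \<Longrightarrow> 0 < \<delta> t" "\<And>a. a \<in> set_pmf (\<nu> i) \<Longrightarrow> \<delta> i \<le> pmf (\<nu> i) a"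
    and \<rho>: "0 \<le> \<rho>" "real (2 * m) * \<rho> \<le> 1" and m: "1 \<le> m"
    and K: "finite K" "\<And>k. 0 \<le> w k"
    and IH: "\<And>(L :: ('a option \<times> 'k) set) w F. finite L \<Longrightarrow> (\<And>k. 0 \<le> w k)
      \<Longrightarrow> noise_moment_bound I \<nu> \<delta> \<rho> m L w F"
  shows "noise_moment_bound (insert i I) \<nu> \<delta> \<rho> m K w F"
proof -
  let ?P = "set_pmf (\<nu> i)" and ?E = "measure_pmf.expectation (prod_space I \<nu>)"
  let ?c = "\<lambda>S. \<Prod>t\<in>S. (1 / \<delta> t) ^ (m - 1)"
  define D where "D = Some ` ?P \<times> K"
  define N where "N = {None :: 'a option} \<times> K"
  \<comment> \<open>index \<open>(None, k)\<close> carries \<open>f\<^sub>0\<close>, index \<open>(Some a, k)\<close> the value of \<open>g\<close> at the letter \<open>a\<close>\<close>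
  define W where "W = (\<lambda>(b, k). (case b of None \<Rightarrow> 1 | Some a \<Rightarrow> pmf (\<nu> i) a) * w k)"
  define H where "H = (\<lambda>(b, k). case b of None \<Rightarrow> site_avg \<nu> i (F k) | Some a \<Rightarrow> site_dev \<nu> i (F k) a)"
  have fin: "finite D" "finite N" "N \<inter> D = {}" and W0: "0 \<le> W k" for k
    using I K unfolding D_def N_def W_def by (auto split: option.splits prod.splits)
  have sumN: "(\<Sum>k\<in>N. W k * \<phi> (H k)) = (\<Sum>k\<in>K. w k * \<phi> (site_avg \<nu> i (F k)))" for \<phi> :: "(('i \<Rightarrow> 'a) \<Rightarrow> real) \<Rightarrow> real"
    unfolding N_def W_def H_def by (simp add: sum.cartesian_product')
  have sumD: "(\<Sum>k\<in>D. W k * \<phi> (H k)) =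
      (\<Sum>a\<in>?P. \<Sum>k\<in>K. pmf (\<nu> i) a * w k * \<phi> (site_dev \<nu> i (F k) a))" for \<phi> :: "(('i \<Rightarrow> 'a) \<Rightarrow> real) \<Rightarrow> real"
    unfolding D_def W_def H_def
    by (simp add: sum.reindex sum.cartesian_product')
  have int: "integrable (measure_pmf (prod_space I \<nu>)) g" for g :: "_ \<Rightarrow> real"
    using I by (intro integrable_measure_pmf_finite finite_set_prod_space) auto
  define B where "B L x = (\<Sum>k\<in>L. W k * (noise_op I \<nu> \<rho> (H k) x)\<^sup>2)" for L x
  define R where "R L S = (\<Sum>k\<in>L. W k * ?E (\<lambda>x. (laplacian I \<nu> S (H k) x)\<^sup>2))" for L S
  \<comment> \<open>In the one-site inequality, \<open>A\<close> is \<open>B N x\<close> and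
    \<open>s\<close> is \<open>B D x\<close>, so that \<open>A + s\<close> is the squared norm over
    \<open>N \<union> D\<close>.\<close>
  have site: "site_avg \<nu> i (\<lambda>x. (\<Sum>k\<in>K. w k * (noise_op (insert i I) \<nu> \<rho> (F k) x)\<^sup>2) ^ m) x
      \<le> (B (N \<union> D) x) ^ m + (1 / \<delta> i) ^ (m - 1) * (B D x) ^ m" for x
  proof -
    have "B (N \<union> D) x = B N x + B D x"
      unfolding B_def using fin by (simp add: sum.union_disjoint)
    moreover have "(\<Sum>a\<in>?P. pmf (\<nu> i) a * (\<Sum>k\<in>K. w k * (noise_op I \<nu> \<rho> (site_avg \<nu> i (F k)) x
          + \<rho> * noise_op I \<nu> \<rho> (site_dev \<nu> i (F k) a) x)\<^sup>2) ^ m)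
        \<le> ((\<Sum>k\<in>K. w k * (noise_op I \<nu> \<rho> (site_avg \<nu> i (F k)) x)\<^sup>2)
          + (\<Sum>a\<in>?P. \<Sum>k\<in>K. pmf (\<nu> i) a * w k * (noise_op I \<nu> \<rho> (site_dev \<nu> i (F k) a) x)\<^sup>2)) ^ m
        + (1 / \<delta> i) ^ (m - 1) * (\<Sum>a\<in>?P. \<Sum>k\<in>K. pmf (\<nu> i) a * w k *
            (noise_op I \<nu> \<rho> (site_dev \<nu> i (F k) a) x)\<^sup>2) ^ m"
    proof (rule single_site_inequality)
      show "(\<Sum>a\<in>?P. pmf (\<nu> i) a * noise_op I \<nu> \<rho> (site_dev \<nu> i (F k) a) x) = 0" for k
        unfolding noise_op_eq_es_multiplier using I by (intro es_multiplier_site_dev_mean) auto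
    qed (use I \<delta> \<rho> m K in auto)
    ultimately show ?thesis
      unfolding site_avg_def[of _ _ "\<lambda>x. (\<Sum>k\<in>K. w k * (noise_op (insert i I) \<nu> \<rho> (F k) x)\<^sup>2) ^ m"]
        noise_op_insert[OF I] B_def
        sumN[of "\<lambda>g. (noise_op I \<nu> \<rho> g x)\<^sup>2"] sumD[of "\<lambda>g. (noise_op I \<nu> \<rho> g x)\<^sup>2"]
      by simp
  qed
  have IHL: "?E (\<lambda>x. (B L x) ^ m) \<le> (\<Sum>S\<in>Pow I. ?c S * (R L S) ^ m)" if "finite L" for L
    using IH[OF that W0, where F = H] unfolding noise_moment_bound_def B_def R_def .
  have R1: "R (N \<union> D) S = (\<Sum>k\<in>K. w k * measure_pmf.expectation (prod_space (insert i I) \<nu>)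
      (\<lambda>x. (laplacian (insert i I) \<nu> S (F k) x)\<^sup>2))" if "S \<in> Pow I" for S
  proof -
    have "R (N \<union> D) S = R N S + R D S"
      unfolding R_def using fin by (simp add: sum.union_disjoint)
    also have "\<dots> = (\<Sum>k\<in>K. w k * ?E (\<lambda>x. (laplacian I \<nu> S (site_avg \<nu> i (F k)) x)\<^sup>2))
        + (\<Sum>k\<in>K. \<Sum>a\<in>?P. pmf (\<nu> i) a * w k * ?E (\<lambda>x. (laplacian I \<nu> S (site_dev \<nu> i (F k) a) x)\<^sup>2))"
      unfolding R_def sumN[of "\<lambda>g. ?E (\<lambda>x. (laplacian I \<nu> S g x)\<^sup>2)"]
        sumD[of "\<lambda>g. ?E (\<lambda>x. (laplacian I \<nu> S g x)\<^sup>2)"]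
      by (subst sum.swap) simp
    finally show ?thesis
      using that
      by (simp add: expectation_laplacian_sq_insert_notin[OF I] distrib_left sum.distrib
          sum_distrib_left mult.assoc mult.left_commute)
  qed
  have R2: "R D S = (\<Sum>k\<in>K. w k * measure_pmf.expectation (prod_space (insert i I) \<nu>)
      (\<lambda>x. (laplacian (insert i I) \<nu> (insert i S) (F k) x)\<^sup>2))" if "S \<in> Pow I" for S
  proof -
    have "R D S =
        (\<Sum>k\<in>K. \<Sum>a\<in>?P. pmf (\<nu> i) a * w k * ?E (\<lambda>x. (laplacian I \<nu> S (site_dev \<nu> i (F k) a) x)\<^sup>2))"
      unfolding R_def sumD[of "\<lambda>g. ?E (\<lambda>x. (laplacian I \<nu> S g x)\<^sup>2)"] by (rule sum.swap)
    then show ?thesis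
      using that
      by (simp add: expectation_laplacian_sq_insert_mem[OF I] sum_distrib_left mult.assoc mult.left_commute)
  qed
  \<comment> \<open>The constant in front of the second one-site term is exactly the factor of the
    new coordinate.\<close>
  have c: "?c (insert i S) = (1 / \<delta> i) ^ (m - 1) * ?c S" if "S \<in> Pow I" for S
    using that I finite_subset by (subst prod.insert) auto
  have "measure_pmf.expectation (prod_space (insert i I) \<nu>)
      (\<lambda>x. (\<Sum>k\<in>K. w k * (noise_op (insert i I) \<nu> \<rho> (F k) x)\<^sup>2) ^ m)
      \<le> ?E (\<lambda>x. (B (N \<union> D) x) ^ m + (1 / \<delta> i) ^ (m - 1) * (B D x) ^ m)"
    unfolding expectation_prod_space_insert[OF I] by (intro integral_mono int site)
  also have "\<dots> = ?E (\<lambda>x. (B (N \<union> D) x) ^ m) + (1 / \<delta> i) ^ (m - 1) * ?E (\<lambda>x. (B D x) ^ m)"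
    using int by simp
  also have "\<dots> \<le> (\<Sum>S\<in>Pow I. ?c S * (R (N \<union> D) S) ^ m)
      + (1 / \<delta> i) ^ (m - 1) * (\<Sum>S\<in>Pow I. ?c S * (R D S) ^ m)"
    using \<delta>(1)[of i] by (intro add_mono mult_left_mono IHL) (use fin in auto)
  \<comment> \<open>The \<open>N \<union> D\<close> sum supplies the sets without \<open>i\<close>,
    the \<open>D\<close> sum those with \<open>i\<close>.\<close>
  also have "\<dots> = (\<Sum>S\<in>Pow (insert i I). ?c S *
        (\<Sum>k\<in>K. w k * measure_pmf.expectation (prod_space (insert i I) \<nu>)
          (\<lambda>x. (laplacian (insert i I) \<nu> S (F k) x)\<^sup>2)) ^ m)"
    unfolding sum_Pow_insert[OF I(1,2)] sum_distrib_left
    by (intro arg_cong2[of _ _ _ _ "(+)"] sum.cong refl) (simp_all only: R1 R2 c mult.assoc)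
  finally show ?thesis unfolding noise_moment_bound_def .
qed

lemma vector_noise_moment_bound:
  fixes K :: "'k set" and \<nu> :: "'i \<Rightarrow> 'a pmf"
  assumes "finite I" "\<forall>t\<in>I. finite (set_pmf (\<nu> t))"
    and "\<And>t. t \<in> I \<Longrightarrow> 0 < \<delta> t" "\<And>t a. t \<in> I \<Longrightarrow> a \<in> set_pmf (\<nu> t) \<Longrightarrow> \<delta> t \<le> pmf (\<nu> t) a"
    and \<rho>: "0 \<le> \<rho>" "real (2 * m) * \<rho> \<le> 1" "1 \<le> m"
    and "finite K" "\<And>k. 0 \<le> w k"
  shows "noise_moment_bound I \<nu> \<delta> \<rho> m K w F"
proof -
  \<comment> \<open>The induction runs over natural number indices, with the components and weights
    left arbitrary because each step changes both.\<close>
  have "noise_moment_bound I \<nu> \<delta> \<rho> m L w F"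
    if "finite L" "\<And>k. 0 \<le> w k" for L :: "nat set" and w :: "nat \<Rightarrow> real" and F
    using assms(1-4) that
  proof (induction I arbitrary: L w F rule: finite_induct)
    case empty
    \<comment> \<open>The empty product has one point, where the noise operator and the only
      Laplacian agree, so both sides coincide.\<close>
    have "prod_space {} \<nu> = return_pmf (\<lambda>_. undefined)" by (simp add: prod_space_def)
    moreover have "{S. S = {}} = {{}}" by auto
    ultimately show ?case
      by (simp add: noise_moment_bound_def noise_op_def laplacian_def)
  next
    case (insert i I)
    show ?case
    proof (rule noise_moment_bound_insert)
      fix L' :: "('a option \<times> nat) set" and w :: "'a option \<times> nat \<Rightarrow> real" and F
      assume "finite L'" and w: "\<And>k. 0 \<le> w k"
      then show "noise_moment_bound I \<nu> \<delta> \<rho> m L' w F"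
        by (rule noise_moment_bound_nat_imp[rotated]) (rule insert.IH, use insert.prems in auto)
    qed (use insert \<rho> in auto)
  qed
  then show ?thesis
    using assms by (blast intro: noise_moment_bound_nat_imp)
qed

section \<open>Scalar functions and powers of norms\<close>

theorem theorem6p10:
  fixes n q :: nat
    and \<Omega> :: "nat \<Rightarrow> 'a set"
    and \<nu> :: "nat \<Rightarrow> 'a pmf"
    and f :: "(nat \<Rightarrow> 'a) \<Rightarrow> real"
    and \<rho> :: real
  assumes "\<And>t. t \<in> {1..n} \<Longrightarrow> finite (\<Omega> t)"
    and "\<And>t. t \<in> {1..n} \<Longrightarrow> set_pmf (\<nu> t) \<subseteq> \<Omega> t"
    and "\<And>t. t \<in> {1..n} \<Longrightarrow> 0 < min_prob (\<Omega> t) (\<nu> t) \<and> min_prob (\<Omega> t) (\<nu> t) < 1 / 2"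
    and "even q" and "q > 2"
    and "0 \<le> \<rho>" and "\<rho> \<le> 1 / (8 * real q powr (3 / 2))"
  shows "Lr_norm (prod_space {1..n} \<nu>) (real q) (noise_op {1..n} \<nu> \<rho> f) ^ q
    \<le> (\<Sum>S\<in>Pow {1..n}. sigma_set \<Omega> \<nu> S powi (2 - int q)
          * Lr_norm (prod_space {1..n} \<nu>) 2 (laplacian {1..n} \<nu> S f) ^ q)"
proof -
  let ?I = "{1..n}"
  let ?E = "measure_pmf.expectation (prod_space ?I \<nu>)"
  define p where "p t = min_prob (\<Omega> t) (\<nu> t)" for t
  \<comment> \<open>The atom bound is \<open>\<sigma>\<^sub>t\<^sup>2\<close>, which is at most
    \<open>p t\<close>. With it, \<open>(1 / \<delta> t) ^ (m - 1)\<close> becomes the required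
    power of \<open>\<sigma>\<^sub>t\<close> with exponent \<open>2 - q\<close>.\<close>
  define \<delta> where "\<delta> t = p t * (1 - p t)" for t
  obtain m where qm: "q = 2 * m" using \<open>even q\<close> by (auto elim: evenE)
  then have m: "1 \<le> m" using \<open>q > 2\<close> by auto
  have p: "0 < p t" "p t < 1 / 2" if "t \<in> ?I" for t
    using assms(3)[OF that] by (auto simp: p_def)
  have \<delta>0: "0 < \<delta> t" if "t \<in> ?I" for t
    using p[OF that] by (auto simp: \<delta>_def)
  have \<delta>_le: "\<delta> t \<le> pmf (\<nu> t) a" if t: "t \<in> ?I" and a: "a \<in> set_pmf (\<nu> t)" for t a
  proof -
    have "\<delta> t \<le> p t * 1" unfolding \<delta>_def using p[OF t] by (intro mult_left_mono) auto
    also have "p t * 1 \<le> pmf (\<nu> t) a"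
      unfolding p_def min_prob_def using assms(1,2)[OF t] a by auto
    finally show ?thesis .
  qed
  have fin: "finite (set_pmf (\<nu> t))" if "t \<in> ?I" for t
    using assms(1,2)[OF that] finite_subset by blast
  \<comment> \<open>The bound on \<open>\<rho>\<close> enters as \<open>q * \<rho> \<le> 1\<close>,
    which follows from \<open>q \<le> 8 * q powr (3 / 2)\<close>.\<close>
  have \<rho>: "real (2 * m) * \<rho> \<le> 1"
  proof -
    have q1: "1 \<le> real q" using \<open>q > 2\<close> by simp
    then have "real q powr 1 \<le> real q powr (3 / 2)" by (intro powr_mono) auto
    then have "real q \<le> 8 * real q powr (3 / 2)" using q1 by simp
    moreover from this have "\<rho> * (8 * real q powr (3 / 2)) \<le> 1"
      using assms(7) q1 by (simp add: field_simps)
    ultimately have "\<rho> * real q \<le> 1"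
      using mult_left_mono[OF _ \<open>0 \<le> \<rho>\<close>] order_trans by blast
    then show ?thesis by (simp add: qm mult.commute)
  qed
  \<comment> \<open>A real function is a vector with a single component of weight one.\<close>
  have "noise_moment_bound ?I \<nu> \<delta> \<rho> m {()} (\<lambda>_. 1) (\<lambda>_. f)"
    by (rule vector_noise_moment_bound) (use fin \<delta>0 \<delta>_le \<rho> m assms(6) in auto)
  then have main: "?E (\<lambda>x. (noise_op ?I \<nu> \<rho> f x) ^ q)
      \<le> (\<Sum>S\<in>Pow ?I. (\<Prod>t\<in>S. (1 / \<delta> t) ^ (m - 1)) * (?E (\<lambda>x. (laplacian ?I \<nu> S f x)\<^sup>2)) ^ m)"
    by (simp add: noise_moment_bound_def qm power_mult)
  have norm_q: "Lr_norm (prod_space ?I \<nu>) (real q) g ^ q = ?E (\<lambda>x. g x ^ q)" for g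
  proof -
    have "\<bar>g x\<bar> powr real q = g x ^ q" for x
      using \<open>q > 2\<close> \<open>even q\<close> by (simp add: powr_realpow' power_even_abs)
    moreover have "0 \<le> ?E (\<lambda>x. g x ^ q)"
      using \<open>even q\<close> by (intro integral_nonneg_AE) (simp add: zero_le_even_power)
    ultimately show ?thesis
      unfolding Lr_norm_def using \<open>q > 2\<close>
      by (simp add: powr_powr flip: powr_realpow')
  qed
  have norm_2: "Lr_norm (prod_space ?I \<nu>) 2 g ^ q = (?E (\<lambda>x. (g x)\<^sup>2)) ^ m" for g
  proof -
    have "\<bar>g x\<bar> powr 2 = (g x)\<^sup>2" for x
      by simp
    moreover have "0 \<le> ?E (\<lambda>x. (g x)\<^sup>2)"
      by (intro integral_nonneg_AE) simp
    ultimately show ?thesis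
      unfolding Lr_norm_def qm power_mult by (simp add: powr_half_sqrt)
  qed
  have sig: "sigma_set \<Omega> \<nu> S powi (2 - int q) = (\<Prod>t\<in>S. (1 / \<delta> t) ^ (m - 1))" if "S \<in> Pow ?I" for S
  proof -
    \<comment> \<open>The exponent is an even nonpositive integer, so the square roots in
      \<open>sigma_set\<close> disappear.\<close>
    have "2 - int q = - int (2 * (m - 1))" using qm m by auto
    then have "sigma_set \<Omega> \<nu> S powi (2 - int q) = inverse (((sigma_set \<Omega> \<nu> S)\<^sup>2) ^ (m - 1))"
      by (simp only: power_int_minus power_int_of_nat power_mult)
    also have "(sigma_set \<Omega> \<nu> S)\<^sup>2 = (\<Prod>t\<in>S. \<delta> t)"
      unfolding sigma_set_def prod_power_distrib
      by (rule prod.cong) (use that \<delta>0 in \<open>force simp: \<delta>_def p_def\<close>)+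
    finally show ?thesis
      by (simp add: prod_power_distrib prod_dividef power_one_over inverse_eq_divide)
  qed
  note main
  also have "(\<Sum>S\<in>Pow ?I. (\<Prod>t\<in>S. (1 / \<delta> t) ^ (m - 1)) * (?E (\<lambda>x. (laplacian ?I \<nu> S f x)\<^sup>2)) ^ m)
      = (\<Sum>S\<in>Pow ?I. sigma_set \<Omega> \<nu> S powi (2 - int q)
          * Lr_norm (prod_space ?I \<nu>) 2 (laplacian ?I \<nu> S f) ^ q)"
    by (intro sum.cong refl) (simp only: sig norm_2)
  finally show ?thesis unfolding norm_q .
qed

end
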